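(* Let $g(z)=z+\sum_{n\ge 2}g_nz^n\in\mathbb{A}$, write $[n]_g=g_n$, and let $\phi(z)=1+B_1z+B_2z^2+\cdots$ be as in the context. If $f(z)=z+\sum_{n\ge2}a_nz^n\in\mathbb{A}$ belongs to $\mathcal{C}_g(\phi)$, then the symmetric Toeplitz determinant $$\mathcal{T}_3(1)=\begin{vmatrix} 1 & a_2 & a_3 \\ a_2 & 1 & a_2 \\ a_3 & a_2 & 1 \end{vmatrix}$$ satisfies $$|\mathcal{T}_3(1)|\le\left(1+\frac{B_1}{[3]_g([3]_g-1)}\max\left\{1,\left|\frac{B_2}{B_1}+\frac{B_1}{[2]_g-1}\left(1-\frac{2[3]_g([3]_g-1)}{[2]_g^2([2]_g-1)}\right)\right|\right\}\right)\left(1+\frac{B_1}{[3]_g([3]_g-1)}\max\left\{1,\left|\frac{B_2}{B_1}+\frac{B_1}{[2]_g-1}\right|\right\}\right).$$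
   Context: $\mathbb{U}=\{z\in\mathbb{C}:|z|<1\}$, and $\mathbb{A}$ is the set of analytic functions $f$ on $\mathbb{U}$ with $f(0)=0$, $f'(0)=1$, i.e. $f(z)=z+\sum_{n\ge2}a_nz^n$. For analytic $F,\phi$ on $\mathbb{U}$, $F\prec\phi$ (subordination) means there is an analytic $u$ on $\mathbb{U}$ with $u(0)=0$, $|u(z)|<1$ and $F(z)=\phi(u(z))$ for all $z\in\mathbb{U}$. For $g(z)=z+\sum_{n\ge2}g_nz^n\in\mathbb{A}$, the $g$-derivative of $f\in\mathbb{A}$ is $D_gf(z)=\frac1z\left(z+\sum_{n\ge2}[n]_ga_nz^n\right)$, where $[n]_g=g_n$ (so $zD_gf\in\mathbb{A}$ is the convolution, i.e. Hadamard product, of $f$ and $g$). The function $\phi$ is analytic on $\mathbb{U}$ with positive real part, $\phi(0)=1$, $\phi'(0)>0$, $\phi(\mathbb{U})$ symmetric with respect to the real axis, with expansion $\phi(z)=1+B_1z+B_2z^2+B_3z^3+\cdots$, $B_1>0$. The class $\mathcal{C}_g(\phi)$ consists of all $f\in\mathbb{A}$ such that $\frac{D_g(zD_gf(z))}{D_gf(z)}\prec\phi(z)$.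
   Formalization: The factor B_1/([3]_g([3]_g-1)) is replaced by B_1/|[3]_g([3]_g-1)|, since the printed bound fails for negative and is undefined for non-real [3]_g([3]_g-1); the numbers [2]_g, [2]_g-1, [3]_g, [3]_g-1 are assumed nonzero so that the bound is defined. *)

theory Defs
  imports "HOL-Complex_Analysis.Complex_Analysis"
begin

abbreviation unit_disc :: "complex set" where
  "unit_disc \<equiv> ball 0 1"

abbreviation taylor_coeff :: "(complex \<Rightarrow> complex) \<Rightarrow> nat \<Rightarrow> complex" where
  "taylor_coeff f n \<equiv> fps_nth (fps_expansion f 0) n"

text \<open>The class \<open>\<A>\<close> of normalised analytic functions on the unit disc.\<close>

definition class_A :: "(complex \<Rightarrow> complex) set" where
  "class_A = {f. f holomorphic_on unit_disc \<and> f 0 = 0 \<and> deriv f 0 = 1}"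

definition subordinate :: "(complex \<Rightarrow> complex) \<Rightarrow> (complex \<Rightarrow> complex) \<Rightarrow> bool"
  (infix \<open>\<prec>\<^sub>s\<close> 50) where
  "F \<prec>\<^sub>s \<phi> \<longleftrightarrow>
     F holomorphic_on unit_disc \<and> \<phi> holomorphic_on unit_disc \<and>
     (\<exists>u. u holomorphic_on unit_disc \<and> u 0 = 0 \<and>
          (\<forall>z\<in>unit_disc. norm (u z) < 1 \<and> F z = \<phi> (u z)))"

text \<open>The \<open>g\<close>-number \<open>[n]\<^sub>g\<close> is the \<open>n\<close>-th Taylor coefficient of \<open>g\<close>.\<close>

definition g_number :: "(complex \<Rightarrow> complex) \<Rightarrow> nat \<Rightarrow> complex" where
  "g_number g n = taylor_coeff g n"

text \<open>The \<open>g\<close>-derivative; the singularity of \<open>1/z\<close> at \<open>0\<close> is removable, with value \<open>1\<close>.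
  The sum over \<open>n \<ge> 2\<close> is reindexed from \<open>0\<close>.\<close>

definition g_deriv :: "(complex \<Rightarrow> complex) \<Rightarrow> (complex \<Rightarrow> complex) \<Rightarrow> complex \<Rightarrow> complex" where
  "g_deriv g f z =
     (if z = 0 then 1
      else 1 / z * (z + (\<Sum>n. g_number g (n + 2) * taylor_coeff f (n + 2) * z ^ (n + 2))))"

text \<open>No univalence is required of \<open>\<phi>\<close>, so its higher Taylor coefficients may be complex.\<close>

definition admissible_phi :: "(complex \<Rightarrow> complex) \<Rightarrow> bool" where
  "admissible_phi \<phi> \<longleftrightarrow>
     \<phi> holomorphic_on unit_disc \<and> (\<forall>z\<in>unit_disc. Re (\<phi> z) > 0) \<and> \<phi> 0 = 1 \<and>
     deriv \<phi> 0 \<in> \<real> \<and> Re (deriv \<phi> 0) > 0 \<and>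
     cnj ` (\<phi> ` unit_disc) = \<phi> ` unit_disc"

text \<open>Division by zero yields \<open>0\<close> here, while \<open>\<phi>\<close> has positive real part; for such \<open>\<phi>\<close>,
  membership therefore forces \<open>g_deriv g f\<close> to have no zeros in the disc.\<close>

definition class_C :: "(complex \<Rightarrow> complex) \<Rightarrow> (complex \<Rightarrow> complex) \<Rightarrow> (complex \<Rightarrow> complex) set" where
  "class_C g \<phi> =
     {f \<in> class_A. (\<lambda>z. g_deriv g (\<lambda>w. w * g_deriv g f w) z / g_deriv g f z) \<prec>\<^sub>s \<phi>}"

end

theory Submission
  imports Defs
begin

text \<open>
  Expanding along the symmetry, the determinant factors as
  \<open>(1 - a\<^sub>3) * (1 + a\<^sub>3 - 2 * a\<^sub>2\<^sup>2)\<close>, and each of the two factors contributes one factor of the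
  bound. Let \<open>u(z) = c\<^sub>1 z + c\<^sub>2 z\<^sup>2 + \<dots>\<close> be the self-map of the disc that realises the subordination.
  Comparing Taylor coefficients in \<open>D\<^sub>g(z D\<^sub>g f) = \<phi>(u) * D\<^sub>g f\<close> expresses \<open>a\<^sub>2\<close> through \<open>c\<^sub>1\<close> and \<open>a\<^sub>3\<close>
  through \<open>c\<^sub>1\<close> and \<open>c\<^sub>2\<close> (lemma \<open>class_C_coefficients\<close>). Both \<open>a\<^sub>3\<close> and \<open>a\<^sub>3 - 2 * a\<^sub>2\<^sup>2\<close> take the form
  \<open>B\<^sub>1 / (g\<^sub>3 (g\<^sub>3 - 1)) * (c\<^sub>2 + t * c\<^sub>1\<^sup>2)\<close>, for two different constants \<open>t\<close>.

  The analytic input is the inequality \<open>norm (c\<^sub>2 + t * c\<^sub>1\<^sup>2) \<le> max 1 (norm t)\<close> for self-maps of the disc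
  fixing the origin (lemma \<open>self_map_coeff_functional_bound\<close>). It follows from
  \<open>norm c\<^sub>2 \<le> 1 - (norm c\<^sub>1)\<^sup>2\<close>, which is the Schwarz--Pick inequality at the origin for \<open>u(z) / z\<close>.
\<close>

section \<open>Initial coefficients of self-maps of the disc\<close>

text \<open>The Moebius transformation of the disc that carries \<open>v 0\<close> to the origin has derivative
  \<open>1 / (1 - (norm (v 0))\<^sup>2)\<close> at \<open>v 0\<close>, so the bound is the Schwarz lemma for its composition
  with \<open>v\<close>.\<close>

lemma Schwarz_Pick_deriv_at_0:
  assumes holv: "v holomorphic_on ball 0 1"
    and v1: "\<And>z. norm z < 1 \<Longrightarrow> norm (v z) < 1"
  shows "norm (deriv v 0) \<le> 1 - (norm (v 0))\<^sup>2"
proof -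
  define a where "a = v 0"
  have a: "norm a < 1"
    using v1[of 0] by (simp add: a_def)
  then have a2: "(norm a)\<^sup>2 < 1"
    by (simp add: abs_square_less_1)
  define m where "m = Moebius_function 0 a"
  have na: "1 - cnj a * a = of_real (1 - (norm a)\<^sup>2)"
    using complex_norm_square[of a] by (simp add: mult.commute)
  have nz: "1 - cnj a * a \<noteq> 0"
    using a2 unfolding na of_real_eq_0_iff by linarith
  have dm: "(m has_field_derivative 1 / (1 - cnj a * a)) (at a)"
    unfolding m_def Moebius_function_simple
    by (rule derivative_eq_intros refl nz | simp)+
  have dv: "(v has_field_derivative deriv v 0) (at 0)"
    using holv by (intro holomorphic_derivI) auto
  have dw: "(m \<circ> v has_field_derivative 1 / (1 - cnj a * a) * deriv v 0) (at 0)"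
    using dm dv by (intro DERIV_chain) (auto simp: a_def)
  have holm: "m holomorphic_on ball 0 1"
    unfolding m_def by (rule Moebius_function_holomorphic[OF a])
  have "norm (deriv (m \<circ> v) 0) \<le> 1"
  proof (rule Schwarz_Lemma(2))
    show "m \<circ> v holomorphic_on ball 0 1"
      using holv holm v1 by (intro holomorphic_on_compose_gen[of _ _ _ "ball 0 1"]) auto
    show "(m \<circ> v) 0 = 0"
      by (simp add: m_def a_def Moebius_function_eq_zero)
    show "norm ((m \<circ> v) z) < 1" if "norm z < 1" for z
      using Moebius_function_norm_lt_1[OF a v1[OF that]] by (simp add: m_def)
    show "norm (0::complex) < 1" by simp
  qed
  then have "norm (deriv v 0) / (1 - (norm a)\<^sup>2) \<le> 1"
    using DERIV_imp_deriv[OF dw] a2 by (simp add: na norm_divide norm_mult del: of_real_diff)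
  then show ?thesis
    using a2 by (simp add: a_def field_simps)
qed

text \<open>The second coefficient of \<open>u\<close> is the derivative at the origin of \<open>u(z) / z\<close>. By the Schwarz lemma
  this quotient is again a self-map of the open disc unless \<open>u\<close> is a rotation.\<close>

lemma self_map_second_coeff_bound:
  assumes holu: "u holomorphic_on unit_disc" and u0: "u 0 = 0"
    and u1: "\<And>z. norm z < 1 \<Longrightarrow> norm (u z) < 1"
  shows "norm (taylor_coeff u 2) \<le> 1 - (norm (taylor_coeff u 1))\<^sup>2"
proof -
  obtain v where holv: "v holomorphic_on ball 0 1"
    and uv: "\<And>z. norm z < 1 \<Longrightarrow> u z = z * v z" and v0: "deriv u 0 = v 0"
    using Schwarz3[OF holu u0] by metis
  have V: "v has_fps_expansion fps_expansion v 0"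
    using holv by (intro has_fps_expansion_fps_expansion[of "ball 0 1"]) auto
  have "(\<lambda>z. z * v z) has_fps_expansion fps_X * fps_expansion v 0"
    by (intro fps_expansion_intros V)
  moreover have "eventually (\<lambda>z. u z = z * v z) (nhds 0)"
    using uv by (intro eventually_nhds_in_open[of "ball 0 1", THEN eventually_mono]) auto
  ultimately have "u has_fps_expansion fps_X * fps_expansion v 0"
    by (simp cong: has_fps_expansion_cong)
  then have U: "fps_expansion u 0 = fps_X * fps_expansion v 0"
    by (rule fps_expansion_eqI)
  have c1: "taylor_coeff u 1 = v 0" and c2: "taylor_coeff u 2 = deriv v 0"
    unfolding U by (simp_all add: fps_expansion_def)
  show ?thesis
  proof (cases "(\<exists>z. norm z < 1 \<and> z \<noteq> 0 \<and> norm (u z) = norm z) \<or> norm (deriv u 0) = 1")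
    case True
    \<comment> \<open>Here \<open>u\<close> is a rotation, so \<open>v\<close> is a constant of modulus one.\<close>
    then obtain \<alpha> where \<alpha>: "\<And>z. norm z < 1 \<Longrightarrow> u z = \<alpha> * z" "norm \<alpha> = 1"
      using Schwarz_Lemma(3)[OF holu u0 u1, of 0] by auto
    have "(\<lambda>z. \<alpha> * z) has_fps_expansion fps_const \<alpha> * fps_X"
      by (intro fps_expansion_intros)
    moreover have "eventually (\<lambda>z. u z = \<alpha> * z) (nhds 0)"
      using \<alpha> by (intro eventually_nhds_in_open[of "ball 0 1", THEN eventually_mono]) auto
    ultimately have "u has_fps_expansion fps_const \<alpha> * fps_X"
      by (simp cong: has_fps_expansion_cong)
    then have "fps_expansion u 0 = fps_const \<alpha> * fps_X"
      by (rule fps_expansion_eqI)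
    then show ?thesis
      using \<alpha> by simp
  next
    case False
    have "norm (v z) < 1" if z: "norm z < 1" for z
    proof (cases "z = 0")
      case True
      then show ?thesis
        using False Schwarz_Lemma(2)[OF holu u0 u1 z] v0 by auto
    next
      case nz: False
      then have "norm (u z) < norm z"
        using False Schwarz_Lemma(1)[OF holu u0 u1 z] z by fastforce
      then show ?thesis
        using nz by (simp add: uv[OF z] norm_mult)
    qed
    from Schwarz_Pick_deriv_at_0[OF holv this] show ?thesis
      unfolding c1 c2 .
  qed
qed

text \<open>The bound on the second coefficient \<open>c\<^sub>2\<close> turns the left-hand side into at most
  \<open>(1 - x) + norm t * x\<close> with \<open>x = (norm c\<^sub>1)\<^sup>2 \<in> {0..1}\<close>, a convex combination of \<open>1\<close> and \<open>norm t\<close>.\<close>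

lemma self_map_coeff_functional_bound:
  assumes "u holomorphic_on unit_disc" "u 0 = 0" "\<And>z. norm z < 1 \<Longrightarrow> norm (u z) < 1"
  shows "norm (taylor_coeff u 2 + t * (taylor_coeff u 1)\<^sup>2) \<le> max 1 (norm t)"
proof -
  define x where "x = (norm (taylor_coeff u 1))\<^sup>2"
  have c2: "norm (taylor_coeff u 2) \<le> 1 - x"
    unfolding x_def by (rule self_map_second_coeff_bound[OF assms])
  then have x: "0 \<le> x" "0 \<le> 1 - x"
    using norm_ge_zero[of "taylor_coeff u 2"] by (simp add: x_def, linarith)
  have "norm (taylor_coeff u 2 + t * (taylor_coeff u 1)\<^sup>2)
      \<le> norm (taylor_coeff u 2) + norm t * x"
    by (metis norm_triangle_ineq norm_mult norm_power x_def)
  also have "\<dots> \<le> (1 - x) * 1 + x * norm t"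
    using c2 by simp
  also have "\<dots> \<le> (1 - x) * max 1 (norm t) + x * max 1 (norm t)"
    using x by (intro add_mono mult_left_mono) auto
  finally show ?thesis
    by (simp add: algebra_simps)
qed

section \<open>Power series of the g-derivative\<close>

definition fps_hadamard :: "'a::times fps \<Rightarrow> 'a fps \<Rightarrow> 'a fps" where
  "fps_hadamard F G = Abs_fps (\<lambda>n. fps_nth F n * fps_nth G n)"

lemma fps_hadamard_nth [simp]: "fps_nth (fps_hadamard F G) n = fps_nth F n * fps_nth G n"
  by (simp add: fps_hadamard_def)

text \<open>If both factors converge absolutely at \<open>r > 0\<close>, the terms of \<open>G\<close> are bounded there, so the
  Hadamard product at \<open>r\<^sup>2\<close> is dominated by a multiple of the series of \<open>F\<close> at \<open>r\<close>.\<close>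

lemma fps_conv_radius_hadamard_pos:
  fixes F G :: "complex fps"
  assumes "fps_conv_radius F > 0" "fps_conv_radius G > 0"
  shows "fps_conv_radius (fps_hadamard F G) > 0"
proof -
  have "0 < min (fps_conv_radius F) (fps_conv_radius G)"
    using assms by simp
  from ereal_dense2[OF this]
  obtain r where r: "0 < ereal r" "ereal r < min (fps_conv_radius F) (fps_conv_radius G)"
    by blast
  let ?r = "of_real r :: complex"
  have F: "summable (\<lambda>n. norm (fps_nth F n * ?r ^ n))"
    and G: "summable (\<lambda>n. norm (fps_nth G n * ?r ^ n))"
    using r unfolding fps_conv_radius_def by (auto intro!: abs_summable_in_conv_radius)
  have "Bseq (\<lambda>n. fps_nth G n * ?r ^ n)"
    using summable_LIMSEQ_zero[OF summable_norm_cancel[OF G]]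
    by (intro convergent_imp_Bseq) (auto simp: convergent_def)
  then obtain K where K: "\<And>n. norm (fps_nth G n * ?r ^ n) \<le> K"
    by (auto simp: Bseq_def)
  have "summable (\<lambda>n. fps_nth (fps_hadamard F G) n * (?r\<^sup>2) ^ n)"
  proof (rule summable_comparison_test')
    show "summable (\<lambda>n. norm (fps_nth F n * ?r ^ n) * K)"
      using F by (rule summable_mult2)
    show "norm (fps_nth (fps_hadamard F G) n * (?r\<^sup>2) ^ n) \<le> norm (fps_nth F n * ?r ^ n) * K"
      if "n \<ge> 0" for n
    proof -
      have "fps_nth (fps_hadamard F G) n * (?r\<^sup>2) ^ n
          = (fps_nth F n * ?r ^ n) * (fps_nth G n * ?r ^ n)"
        by (simp add: power2_eq_square power_mult_distrib algebra_simps)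
      then show ?thesis
        using mult_left_mono[OF K norm_ge_zero] by (metis norm_mult)
    qed
  qed
  then have "ereal (norm (?r\<^sup>2)) \<le> fps_conv_radius (fps_hadamard F G)"
    unfolding fps_conv_radius_def by (rule conv_radius_geI)
  moreover have "0 < ereal (norm (?r\<^sup>2))"
    using r by (simp add: norm_power)
  ultimately show ?thesis
    by (rule less_le_trans[rotated])
qed

text \<open>The normalisations of \<open>f\<close> and \<open>g\<close> make \<open>z\<close> the first term of the Hadamard product, so the
  leading \<open>z\<close> and the value \<open>1\<close> at the origin in the g-derivative agree with the shifted series.\<close>

lemma g_deriv_has_fps_expansion:
  assumes F: "f has_fps_expansion F" and G: "g has_fps_expansion G"
    and F01: "fps_nth F 0 = 0" "fps_nth F 1 = 1" and G1: "fps_nth G 1 = 1"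
  shows "g_deriv g f has_fps_expansion fps_shift 1 (fps_hadamard F G)"
proof -
  define H where "H = fps_hadamard F G"
  have H01: "fps_nth H 0 = 0" "fps_nth H 1 = 1"
    using F01 G1 by (simp_all add: H_def)
  have rad: "fps_conv_radius H > 0"
    using F G unfolding H_def has_fps_expansion_def by (intro fps_conv_radius_hadamard_pos) auto
  then have H: "eval_fps H has_fps_expansion H"
    by (rule eval_fps_has_fps_expansion)
  have "H \<noteq> 0"
    using H01 by auto
  then have "1 \<le> subdegree H"
    using H01 by (intro subdegree_geI) auto
  then have "(\<lambda>z. if z = 0 then 1 else eval_fps H z / z ^ 1) has_fps_expansion fps_shift 1 H"
    using H H01 by (intro has_fps_expansion_shift) auto
  moreover have "eventually (\<lambda>z. g_deriv g f z = (if z = 0 then 1 else eval_fps H z / z ^ 1)) (nhds 0)"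
  proof -
    have "eventually (\<lambda>z. z \<in> eball 0 (fps_conv_radius H)) (nhds 0)"
      using rad by (intro eventually_nhds_in_open) (auto simp: zero_ereal_def)
    then show ?thesis
    proof eventually_elim
      case (elim z)
      have "summable (\<lambda>n. fps_nth H n * z ^ n)"
        using elim by (intro summable_fps) auto
      from suminf_split_initial_segment[OF this, of 2]
      have "eval_fps H z = z + (\<Sum>n. fps_nth H (n + 2) * z ^ (n + 2))"
        using H01 by (simp add: eval_fps_def eval_nat_numeral)
      moreover have "g_number g n * taylor_coeff f n = fps_nth H n" for n
        by (simp add: H_def g_number_def fps_expansion_eqI[OF F] fps_expansion_eqI[OF G])
      ultimately show ?case
        by (simp add: g_deriv_def)
    qed
  qed
  ultimately show ?thesis
    unfolding H_def by (subst has_fps_expansion_cong) auto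
qed

lemma class_A_coeffs:
  assumes "f \<in> class_A"
  shows "f has_fps_expansion fps_expansion f 0" "taylor_coeff f 0 = 0" "taylor_coeff f 1 = 1"
proof -
  show "f has_fps_expansion fps_expansion f 0"
    using assms unfolding class_A_def
    by (intro has_fps_expansion_fps_expansion[of unit_disc]) auto
  show "taylor_coeff f 0 = 0" "taylor_coeff f 1 = 1"
    using assms by (simp_all add: class_A_def fps_expansion_def)
qed

text \<open>Near the origin \<open>D\<^sub>g f\<close> does not vanish, so the subordination may be multiplied out there and the
  coefficients of \<open>z\<close> and \<open>z\<^sup>2\<close> compared.\<close>

lemma class_C_coefficients:
  assumes g: "g \<in> class_A" and fC: "f \<in> class_C g \<phi>" and phi0: "\<phi> 0 = 1"
  obtains u where "u holomorphic_on unit_disc" "u 0 = 0" "\<And>z. norm z < 1 \<Longrightarrow> norm (u z) < 1"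
    "g_number g 2 * (g_number g 2 - 1) * taylor_coeff f 2 = taylor_coeff \<phi> 1 * taylor_coeff u 1"
    "g_number g 3 * (g_number g 3 - 1) * taylor_coeff f 3 =
       taylor_coeff \<phi> 1 * taylor_coeff u 2 + taylor_coeff \<phi> 2 * (taylor_coeff u 1)\<^sup>2
       + taylor_coeff \<phi> 1 * taylor_coeff u 1 * (g_number g 2 * taylor_coeff f 2)"
proof -
  have f: "f \<in> class_A"
    using fC by (simp add: class_C_def)
  from fC obtain u where hol\<phi>: "\<phi> holomorphic_on unit_disc"
    and holu: "u holomorphic_on unit_disc" and u0: "u 0 = 0"
    and u1: "\<And>z. norm z < 1 \<Longrightarrow> norm (u z) < 1"
    and sub: "\<And>z. norm z < 1 \<Longrightarrow>
      g_deriv g (\<lambda>w. w * g_deriv g f w) z / g_deriv g f z = \<phi> (u z)"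
    by (auto simp: class_C_def subordinate_def)
  define F G \<Phi> U where "F = fps_expansion f 0" and "G = fps_expansion g 0"
    and "\<Phi> = fps_expansion \<phi> 0" and "U = fps_expansion u 0"
  define P where "P = fps_shift 1 (fps_hadamard F G)"
  define Q where "Q = fps_shift 1 (fps_hadamard (fps_X * P) G)"
  note Fe = class_A_coeffs[OF f, folded F_def] and Ge = class_A_coeffs[OF g, folded G_def]
  have P: "g_deriv g f has_fps_expansion P"
    unfolding P_def by (rule g_deriv_has_fps_expansion) (use Fe Ge in auto)
  then have "(\<lambda>w. w * g_deriv g f w) has_fps_expansion fps_X * P"
    by (intro fps_expansion_intros)
  then have Q: "g_deriv g (\<lambda>w. w * g_deriv g f w) has_fps_expansion Q"
    unfolding Q_def by (rule g_deriv_has_fps_expansion) (use Fe Ge in \<open>auto simp: P_def\<close>)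
  have \<Phi>: "\<phi> has_fps_expansion \<Phi>"
    unfolding \<Phi>_def using hol\<phi> by (intro has_fps_expansion_fps_expansion[of unit_disc]) auto
  have U: "u has_fps_expansion U"
    unfolding U_def using holu by (intro has_fps_expansion_fps_expansion[of unit_disc]) auto
  have U0: "fps_nth U 0 = 0" and \<Phi>0: "fps_nth \<Phi> 0 = 1"
    using u0 phi0 by (simp_all add: U_def \<Phi>_def fps_expansion_def)
  have D0: "g_deriv g f 0 = 1"
    by (simp add: g_deriv_def)
  have "(g_deriv g f \<longlongrightarrow> 1) (at 0)"
    using has_fps_expansion_imp_continuous[OF P, of UNIV] unfolding continuous_at D0 .
  then have "eventually (\<lambda>z. g_deriv g f z \<noteq> 0) (at 0)"
    by (rule tendsto_imp_eventually_ne) simp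
  then have nz: "eventually (\<lambda>z. g_deriv g f z \<noteq> 0) (nhds 0)"
    using D0 by (simp add: eventually_nhds_conv_at)
  have "eventually (\<lambda>z. norm z < 1) (nhds (0::complex))"
    using eventually_nhds_in_open[of "ball 0 1" "0::complex"] by simp
  with nz have "eventually (\<lambda>z. g_deriv g (\<lambda>w. w * g_deriv g f w) z
      = (\<phi> \<circ> u) z * g_deriv g f z) (nhds 0)"
    by eventually_elim (use sub in \<open>force simp: field_simps\<close>)
  moreover have "(\<lambda>z. (\<phi> \<circ> u) z * g_deriv g f z) has_fps_expansion fps_compose \<Phi> U * P"
    by (intro has_fps_expansion_mult has_fps_expansion_compose \<Phi> U U0 P)
  ultimately have "g_deriv g (\<lambda>w. w * g_deriv g f w) has_fps_expansion fps_compose \<Phi> U * P"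
    by (subst has_fps_expansion_cong) auto
  then have QP: "Q = fps_compose \<Phi> U * P"
    using Q fps_expansion_eqI by metis
  have P0: "fps_nth P 0 = 1" "fps_nth P 1 = fps_nth F 2 * fps_nth G 2"
    "fps_nth P 2 = fps_nth F 3 * fps_nth G 3"
    using Fe Ge by (simp_all add: P_def eval_nat_numeral)
  have Q1: "fps_nth Q 1 = fps_nth F 2 * (fps_nth G 2)\<^sup>2" "fps_nth Q 2 = fps_nth F 3 * (fps_nth G 3)\<^sup>2"
    by (simp_all add: Q_def P_def eval_nat_numeral)
  have C: "fps_nth (fps_compose \<Phi> U) 0 = 1"
    "fps_nth (fps_compose \<Phi> U) 1 = fps_nth \<Phi> 1 * fps_nth U 1"
    "fps_nth (fps_compose \<Phi> U) 2 = fps_nth \<Phi> 1 * fps_nth U 2 + fps_nth \<Phi> 2 * (fps_nth U 1)\<^sup>2"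
    using U0 \<Phi>0 by (simp_all add: fps_compose_nth numeral_2_eq_2 fps_mult_nth)
  have "fps_nth Q 1 = fps_nth (fps_compose \<Phi> U) 0 * fps_nth P 1 + fps_nth (fps_compose \<Phi> U) 1 * fps_nth P 0"
    by (simp add: QP fps_mult_nth)
  then have e2: "fps_nth G 2 * (fps_nth G 2 - 1) * fps_nth F 2 = fps_nth \<Phi> 1 * fps_nth U 1"
    unfolding C P0 Q1 by (simp add: algebra_simps power2_eq_square)
  have "fps_nth Q 2 = fps_nth (fps_compose \<Phi> U) 0 * fps_nth P 2
      + fps_nth (fps_compose \<Phi> U) 1 * fps_nth P 1 + fps_nth (fps_compose \<Phi> U) 2 * fps_nth P 0"
    by (simp add: QP fps_mult_nth numeral_2_eq_2)
  then have e3: "fps_nth G 3 * (fps_nth G 3 - 1) * fps_nth F 3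
      = fps_nth \<Phi> 1 * fps_nth U 2 + fps_nth \<Phi> 2 * (fps_nth U 1)\<^sup>2
        + fps_nth \<Phi> 1 * fps_nth U 1 * (fps_nth G 2 * fps_nth F 2)"
    unfolding C P0 Q1 by (simp add: algebra_simps power2_eq_square)
  show thesis
    by (rule that[OF holu u0 u1])
       (use e2 e3 in \<open>simp_all add: g_number_def F_def G_def \<Phi>_def U_def\<close>)
qed

section \<open>The determinant bound\<close>

theorem theorem3p11:
  fixes f g \<phi> :: "complex \<Rightarrow> complex"
    and a\<^sub>2 a\<^sub>3 g\<^sub>2 g\<^sub>3 B\<^sub>2 :: complex and B\<^sub>1 :: real
  assumes "g \<in> class_A"
    and "g\<^sub>2 = g_number g 2" and "g\<^sub>3 = g_number g 3"
    and "g\<^sub>2 \<noteq> 0" and "g\<^sub>2 \<noteq> 1" and "g\<^sub>3 \<noteq> 0" and "g\<^sub>3 \<noteq> 1"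
    and "admissible_phi \<phi>"
    and "taylor_coeff \<phi> 1 = of_real B\<^sub>1" and "B\<^sub>1 > 0" and "taylor_coeff \<phi> 2 = B\<^sub>2"
    and "f \<in> class_C g \<phi>"
    and "a\<^sub>2 = taylor_coeff f 2" and "a\<^sub>3 = taylor_coeff f 3"
  shows "norm (det (vector [vector [1, a\<^sub>2, a\<^sub>3],
                            vector [a\<^sub>2, 1, a\<^sub>2],
                            vector [a\<^sub>3, a\<^sub>2, 1]] :: complex ^ 3 ^ 3))
    \<le> (1 + B\<^sub>1 / norm (g\<^sub>3 * (g\<^sub>3 - 1)) *
           max 1 (norm (B\<^sub>2 / B\<^sub>1 + B\<^sub>1 / (g\<^sub>2 - 1) *
                        (1 - 2 * g\<^sub>3 * (g\<^sub>3 - 1) / (g\<^sub>2 ^ 2 * (g\<^sub>2 - 1)))))) *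
      (1 + B\<^sub>1 / norm (g\<^sub>3 * (g\<^sub>3 - 1)) *
           max 1 (norm (B\<^sub>2 / B\<^sub>1 + B\<^sub>1 / (g\<^sub>2 - 1))))"
proof -
  obtain u where u: "u holomorphic_on unit_disc" "u 0 = 0" "\<And>z. norm z < 1 \<Longrightarrow> norm (u z) < 1"
    and e2: "g\<^sub>2 * (g\<^sub>2 - 1) * a\<^sub>2 = B\<^sub>1 * taylor_coeff u 1"
    and e3: "g\<^sub>3 * (g\<^sub>3 - 1) * a\<^sub>3 = B\<^sub>1 * taylor_coeff u 2 + B\<^sub>2 * (taylor_coeff u 1)\<^sup>2
       + B\<^sub>1 * taylor_coeff u 1 * (g\<^sub>2 * a\<^sub>2)"
    using class_C_coefficients[OF assms(1,12)] assms by (auto simp: admissible_phi_def)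
  define c\<^sub>1 c\<^sub>2 where "c\<^sub>1 = taylor_coeff u 1" and "c\<^sub>2 = taylor_coeff u 2"
  define K where "K = g\<^sub>3 * (g\<^sub>3 - 1)"
  define s where "s = B\<^sub>2 / B\<^sub>1 + B\<^sub>1 / (g\<^sub>2 - 1)"
  define t where "t = B\<^sub>2 / B\<^sub>1 + B\<^sub>1 / (g\<^sub>2 - 1) *
                        (1 - 2 * g\<^sub>3 * (g\<^sub>3 - 1) / (g\<^sub>2 ^ 2 * (g\<^sub>2 - 1)))"
  have nz: "g\<^sub>2 \<noteq> 0" "g\<^sub>2 - 1 \<noteq> 0" "K \<noteq> 0" "complex_of_real B\<^sub>1 \<noteq> 0"
    using assms by (auto simp: K_def)
  have a2: "a\<^sub>2 = B\<^sub>1 * c\<^sub>1 / (g\<^sub>2 * (g\<^sub>2 - 1))"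
    using e2 nz by (simp add: c\<^sub>1_def field_simps)
  have g2a2: "g\<^sub>2 * a\<^sub>2 = B\<^sub>1 * c\<^sub>1 / (g\<^sub>2 - 1)"
    using nz by (simp add: a2)
  have "K * a\<^sub>3 = B\<^sub>1 * c\<^sub>2 + B\<^sub>2 * c\<^sub>1\<^sup>2 + B\<^sub>1 * c\<^sub>1 * (B\<^sub>1 * c\<^sub>1 / (g\<^sub>2 - 1))"
    using e3 unfolding g2a2 K_def c\<^sub>1_def c\<^sub>2_def .
  also have "\<dots> = B\<^sub>1 * (c\<^sub>2 + s * c\<^sub>1\<^sup>2)"
    using nz by (simp add: s_def field_simps power2_eq_square)
  finally have a3: "a\<^sub>3 = B\<^sub>1 / K * (c\<^sub>2 + s * c\<^sub>1\<^sup>2)"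
    using nz by (simp add: field_simps)
  \<comment> \<open>The quantity subtracted from \<open>s\<close> is the coefficient of \<open>c\<^sub>1\<^sup>2\<close> in \<open>2 * a\<^sub>2\<^sup>2\<close>, divided by \<open>B\<^sub>1 / K\<close>.\<close>
  have t_eq: "t = s - 2 * K * B\<^sub>1 / (g\<^sub>2\<^sup>2 * (g\<^sub>2 - 1)\<^sup>2)"
    using nz unfolding s_def t_def K_def by (simp add: divide_simps) (simp add: algebra_simps power2_eq_square)
  have "2 * a\<^sub>2\<^sup>2 = B\<^sub>1 / K * (2 * K * B\<^sub>1 / (g\<^sub>2\<^sup>2 * (g\<^sub>2 - 1)\<^sup>2) * c\<^sub>1\<^sup>2)"
    using nz by (simp add: a2 power_mult_distrib power_divide) (simp add: power2_eq_square)
  then have a32: "a\<^sub>3 - 2 * a\<^sub>2\<^sup>2 = B\<^sub>1 / K * (c\<^sub>2 + t * c\<^sub>1\<^sup>2)"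
    unfolding a3 t_eq by (simp only: ring_distribs) (simp add: algebra_simps)
  have bound: "norm (B\<^sub>1 / K * (c\<^sub>2 + r * c\<^sub>1\<^sup>2)) \<le> B\<^sub>1 / norm K * max 1 (norm r)" for r
  proof -
    have "norm (B\<^sub>1 / K * (c\<^sub>2 + r * c\<^sub>1\<^sup>2)) = B\<^sub>1 / norm K * norm (c\<^sub>2 + r * c\<^sub>1\<^sup>2)"
      using assms(10) by (simp add: norm_mult norm_divide)
    also have "\<dots> \<le> B\<^sub>1 / norm K * max 1 (norm r)"
      unfolding c\<^sub>1_def c\<^sub>2_def
      using assms(10) by (intro mult_left_mono self_map_coeff_functional_bound u) auto
    finally show ?thesis .
  qed
  have "det (vector [vector [1, a\<^sub>2, a\<^sub>3], vector [a\<^sub>2, 1, a\<^sub>2], vector [a\<^sub>3, a\<^sub>2, 1]] :: complex ^ 3 ^ 3)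
      = (1 + (a\<^sub>3 - 2 * a\<^sub>2\<^sup>2)) * (1 - a\<^sub>3)"
    by (simp add: det_3 power2_eq_square algebra_simps)
  also have "norm \<dots> \<le> (1 + norm (a\<^sub>3 - 2 * a\<^sub>2\<^sup>2)) * (1 + norm a\<^sub>3)"
    unfolding norm_mult
    using norm_triangle_ineq[of 1 "a\<^sub>3 - 2 * a\<^sub>2\<^sup>2"] norm_triangle_ineq4[of 1 a\<^sub>3]
    by (intro mult_mono) auto
  also have "\<dots> \<le> (1 + B\<^sub>1 / norm K * max 1 (norm t)) * (1 + B\<^sub>1 / norm K * max 1 (norm s))"
    using bound[of t] bound[of s] assms(10) unfolding a32 a3[symmetric]
    by (intro mult_mono add_left_mono add_nonneg_nonneg mult_nonneg_nonneg) auto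
  finally show ?thesis
    unfolding K_def s_def t_def .
qed

end
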